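(* For every even integer $t\ge 6$ there is a constant $C_t$ such that $\operatorname{gr}(AC_t,K_k)\le k^{C_t}$ for all $k\ge 2$.
   Context: A grid subgraph on $c$ columns and $r$ rows is a graph whose vertex set is a subset of $[c]\times[r]$ (vertex $(x,y)$ in column $x$, row $y$) and whose edges each join two vertices in the same row or in the same column. $G_{N\times N}=K_N\square K_N$; a spanning grid subgraph is a spanning subgraph of it. An embedding of $H$ (on $c_H$ columns, $r_H$ rows) into $G$ is a pair of injections $\varphi_c:[c_H]\to[c_G]$, $\varphi_r:[r_H]\to[r_G]$ sending every edge $\{(x,y),(x',y')\}$ of $H$ to an edge $\{(\varphi_c(x),\varphi_r(y)),(\varphi_c(x'),\varphi_r(y'))\}$ of $G$; $G$ contains $H$ if one exists. A coclique of size $k$ is a set of $k$ pairwise non-adjacent vertices all in one row or all in one column. $\operatorname{gr}(H,K_k)$ is the least $N$ such that every spanning grid subgraph of $G_{N\times N}$ contains $H$ or a coclique of size $k$. For even $t$, the alternating cycle $AC_t$ is the grid subgraph on $t/2$ columns and $t/2$ rows which is the cycle through the vertices $(1,1),(2,1),(2,2),(3,2),(3,3),\dots,(t/2,t/2-1),(t/2,t/2),(1,t/2)$ in this order. *)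

theory Defs
  imports Complex_Main "HOL-Library.Extended_Real" "HOL-Library.Ramsey"
begin

text \<open>
  Graphs are simple and undirected, with edges as two-element sets of vertices.
  A vertex \<open>(x, y)\<close> lies in column \<open>x\<close> and row \<open>y\<close>; columns and rows are numbered from 1.
\<close>

record grid_graph =
  gcols  :: nat
  grows  :: nat
  gverts :: "(nat \<times> nat) set"
  gedges :: "(nat \<times> nat) set set"

definition same_line :: "nat \<times> nat \<Rightarrow> nat \<times> nat \<Rightarrow> bool" where
  "same_line u v \<longleftrightarrow> fst u = fst v \<or> snd u = snd v"

definition grid_subgraph :: "grid_graph \<Rightarrow> bool" where
  "grid_subgraph G \<longleftrightarrow>
     gverts G \<subseteq> {1..gcols G} \<times> {1..grows G} \<and>
     gedges G \<subseteq> {{u, v} | u v. u \<in> gverts G \<and> v \<in> gverts G \<and> u \<noteq> v \<and> same_line u v}"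

text \<open>The rook graph \<open>G\<^sub>N\<^sub>\<times>\<^sub>N\<close>, i.e. the Cartesian product of \<open>K\<^sub>N\<close> with itself.\<close>

definition full_grid :: "nat \<Rightarrow> grid_graph" where
  "full_grid N =
     \<lparr> gcols = N, grows = N,
       gverts = {1..N} \<times> {1..N},
       gedges = {{u, v} | u v. u \<in> {1..N} \<times> {1..N} \<and> v \<in> {1..N} \<times> {1..N}
                                \<and> u \<noteq> v \<and> same_line u v} \<rparr>"

definition spanning_grid_subgraph :: "nat \<Rightarrow> grid_graph \<Rightarrow> bool" where
  "spanning_grid_subgraph N G \<longleftrightarrow>
     grid_subgraph G \<and> gcols G = N \<and> grows G = N \<and>
     gverts G = gverts (full_grid N) \<and> gedges G \<subseteq> gedges (full_grid N)"

definition grid_embedding ::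
    "grid_graph \<Rightarrow> grid_graph \<Rightarrow> (nat \<Rightarrow> nat) \<Rightarrow> (nat \<Rightarrow> nat) \<Rightarrow> bool" where
  "grid_embedding H G \<phi>c \<phi>r \<longleftrightarrow>
     inj_on \<phi>c {1..gcols H} \<and> \<phi>c ` {1..gcols H} \<subseteq> {1..gcols G} \<and>
     inj_on \<phi>r {1..grows H} \<and> \<phi>r ` {1..grows H} \<subseteq> {1..grows G} \<and>
     (\<forall>e \<in> gedges H. map_prod \<phi>c \<phi>r ` e \<in> gedges G)"

definition grid_contains :: "grid_graph \<Rightarrow> grid_graph \<Rightarrow> bool" where
  "grid_contains G H \<longleftrightarrow> (\<exists>\<phi>c \<phi>r. grid_embedding H G \<phi>c \<phi>r)"

definition coclique :: "grid_graph \<Rightarrow> nat \<Rightarrow> (nat \<times> nat) set \<Rightarrow> bool" where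
  "coclique G k S \<longleftrightarrow>
     S \<subseteq> gverts G \<and> finite S \<and> card S = k \<and> indep S (gedges G) \<and>
     ((\<exists>y. \<forall>v \<in> S. snd v = y) \<or> (\<exists>x. \<forall>v \<in> S. fst v = x))"

text \<open>
  The least \<open>N\<close> is taken in the extended naturals, so that it is \<open>\<infinity>\<close> if there is no such \<open>N\<close>;
  an upper bound by a finite number therefore includes the existence of \<open>N\<close>.
\<close>

definition gr :: "grid_graph \<Rightarrow> nat \<Rightarrow> enat" where
  "gr H k =
     Inf (enat ` {N. \<forall>G. spanning_grid_subgraph N G \<longrightarrow>
                       grid_contains G H \<or> (\<exists>S. coclique G k S)})"

definition cycle_edges :: "'a list \<Rightarrow> 'a set set" where
  "cycle_edges vs = {{vs ! i, vs ! (Suc i mod length vs)} | i. i < length vs}"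

text \<open>For \<open>m = t/2\<close>, the list \<open>(1,1), (2,1), (2,2), (3,2), \<dots>, (m,m-1), (m,m), (1,m)\<close>.\<close>

definition alt_cycle_list :: "nat \<Rightarrow> (nat \<times> nat) list" where
  "alt_cycle_list m =
     concat (map (\<lambda>i. [(i, i), (i + 1, i)]) [1..<m]) @ [(m, m), (1, m)]"

definition AC :: "nat \<Rightarrow> grid_graph" where
  "AC t =
     \<lparr> gcols = t div 2, grows = t div 2,
       gverts = set (alt_cycle_list (t div 2)),
       gedges = cycle_edges (alt_cycle_list (t div 2)) \<rparr>"

end

theory Submission
  imports Defs
begin

text \<open>
  Let \<open>m = t/2\<close>. If a graph has no independent set of size \<open>k\<close>, then fewer than \<open>k * M\<close> of its
  vertices have degree below \<open>M\<close>. Double counting therefore gives a column \<open>w\<close> such that for many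
  columns \<open>x\<close> the set \<open>T\<close> of rows in which \<open>w\<close> and \<open>x\<close> are adjacent is large. Inside \<open>T\<close>, column \<open>x\<close>
  contains a clique \<open>y\<^sub>2, \<dots>, y\<^sub>m\<^sub>-\<^sub>1\<close> with at least \<open>k\<close> common neighbours, two of which, \<open>y\<^sub>1\<close> and \<open>y\<^sub>m\<close>,
  are adjacent in column \<open>w\<close>. Using only polynomially many rows, the same \<open>y\<^sub>1, \<dots>, y\<^sub>m\<close> serve for a
  large set of columns \<open>x\<close>. In that set a path \<open>x\<^sub>2, \<dots>, x\<^sub>m\<close> whose \<open>i\<close>-th edge lies in row \<open>y\<^sub>i\<close>
  closes up with \<open>w\<close> to the alternating cycle.
\<close>

section \<open>Degrees in graphs with small independence number\<close>

text \<open>Adjacency is a relation on bare indices, so that all rows give graphs on one common set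
  of columns, and all columns give graphs on one common set of rows.\<close>

definition no_indep :: "nat \<Rightarrow> 'a set \<Rightarrow> ('a \<Rightarrow> 'a \<Rightarrow> bool) \<Rightarrow> bool" where
  "no_indep k V E \<longleftrightarrow> (\<forall>S\<subseteq>V. card S = k \<longrightarrow> (\<exists>u\<in>S. \<exists>v\<in>S. u \<noteq> v \<and> E u v))"

lemma no_indep_subset: "no_indep k V E \<Longrightarrow> W \<subseteq> V \<Longrightarrow> no_indep k W E"
  unfolding no_indep_def by blast

text \<open>Greedy choice: keeping a vertex and deleting it together with its neighbours costs at
  most \<open>M\<close> vertices, so \<open>j * M\<close> vertices allow \<open>j\<close>
  rounds.\<close>

lemma independent_set_of_small_degrees:
  assumes "symp E" "finite B" "\<And>v. v \<in> B \<Longrightarrow> card {u \<in> B. E v u} < M" "card B \<ge> j * M" "M > 0"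
  shows "\<exists>S\<subseteq>B. card S = j \<and> (\<forall>u\<in>S. \<forall>v\<in>S. u \<noteq> v \<longrightarrow> \<not> E u v)"
  using assms(2-4)
proof (induction j arbitrary: B)
  case 0
  then show ?case by (intro exI[of _ "{}"]) auto
next
  case (Suc j)
  have "card B > 0" using Suc.prems(3) \<open>M > 0\<close> by simp
  then have "B \<noteq> {}" by auto
  then obtain v where v: "v \<in> B" by blast
  define B' where "B' = B - insert v {u \<in> B. E v u}"
  have fin: "finite B'" unfolding B'_def using Suc.prems(1) by simp
  have "card (insert v {u \<in> B. E v u}) \<le> M"
    using Suc.prems(2)[OF v] Suc.prems(1) by (simp add: card_insert_if)
  moreover have "card B' = card B - card (insert v {u \<in> B. E v u})"
    unfolding B'_def using Suc.prems(1) v by (intro card_Diff_subset) auto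
  ultimately have "card B' \<ge> j * M" using Suc.prems(3) by simp
  moreover have "card {x \<in> B'. E u x} < M" if "u \<in> B'" for u
  proof -
    have "card {x \<in> B'. E u x} \<le> card {x \<in> B. E u x}"
      unfolding B'_def using Suc.prems(1) by (intro card_mono) auto
    also have "\<dots> < M" using that Suc.prems(2) unfolding B'_def by blast
    finally show ?thesis .
  qed
  ultimately obtain S where S: "S \<subseteq> B'" "card S = j" "\<forall>u\<in>S. \<forall>v\<in>S. u \<noteq> v \<longrightarrow> \<not> E u v"
    using Suc.IH[OF fin] by blast
  have "v \<notin> S" using S(1) unfolding B'_def by blast
  moreover have "finite S" using S(1) fin finite_subset by blast
  ultimately have "card (insert v S) = Suc j" using S(2) by simp
  moreover have "\<not> E v u \<and> \<not> E u v" if "u \<in> S" for u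
    using that S(1) sympD[OF \<open>symp E\<close>, of u v] unfolding B'_def by blast
  moreover have "insert v S \<subseteq> B" using S(1) v unfolding B'_def by blast
  ultimately show ?case using S(3) by (intro exI[of _ "insert v S"]) blast
qed

lemma card_low_degree_less:
  assumes "symp E" "finite V" "no_indep k V E" "M > 0"
  shows "card {v \<in> V. card {u \<in> V. E v u} < M} < k * M"
proof (rule ccontr)
  let ?B = "{v \<in> V. card {u \<in> V. E v u} < M}"
  assume "\<not> card ?B < k * M"
  moreover have "card {u \<in> ?B. E v u} < M" if "v \<in> ?B" for v
  proof -
    have "card {u \<in> ?B. E v u} \<le> card {u \<in> V. E v u}"
      using \<open>finite V\<close> by (intro card_mono) auto
    then show ?thesis using that by simp
  qed
  ultimately obtain S where "S \<subseteq> ?B" "card S = k" "\<forall>u\<in>S. \<forall>v\<in>S. u \<noteq> v \<longrightarrow> \<not> E u v"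
    using independent_set_of_small_degrees[of E ?B M k] assms by auto
  moreover from \<open>S \<subseteq> ?B\<close> have "S \<subseteq> V" by blast
  ultimately show False using \<open>no_indep k V E\<close> unfolding no_indep_def by blast
qed

lemma obtain_high_degree:
  assumes "symp E" "finite V" "no_indep k V E" "M > 0" "card V \<ge> k * M"
  obtains v where "v \<in> V" "card {u \<in> V. E v u} \<ge> M"
proof -
  have "{v \<in> V. card {u \<in> V. E v u} < M} \<noteq> V"
    using card_low_degree_less[OF assms(1-4)] assms(5) by auto
  then show ?thesis using that by fastforce
qed

section \<open>Cliques and paths by nested neighbourhoods\<close>

text \<open>Passing \<open>p\<close> times to the neighbourhood of a vertex of high degree costs a
  factor \<open>k\<close> each time. The chosen vertices are pairwise adjacent and at least
  \<open>k\<close> common neighbours \<open>D\<close> remain. The list records adjacency of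
  consecutive clique vertices only.\<close>

lemma clique_with_common_neighbours:
  assumes "symp E" "irreflp E" "k > 0" "finite V" "no_indep k V E" "card V \<ge> k ^ Suc p"
  shows "\<exists>zs D. length zs = p \<and> distinct zs \<and> set zs \<subseteq> V \<and> successively E zs \<and>
           D \<subseteq> V - set zs \<and> card D \<ge> k \<and> (\<forall>z\<in>set zs. \<forall>d\<in>D. E z d)"
  using assms(4-6)
proof (induction p arbitrary: V)
  case 0
  then show ?case by (intro exI[of _ "[]"] exI[of _ V]) simp
next
  case (Suc p)
  obtain v where v: "v \<in> V" "card {u \<in> V. E v u} \<ge> k ^ Suc p"
    by (rule obtain_high_degree[OF assms(1) Suc.prems(1,2), of "k ^ Suc p"])
      (use \<open>k > 0\<close> Suc.prems(3) in auto)
  define V' where "V' = {u \<in> V. E v u}"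
  have "V' \<subseteq> V" unfolding V'_def by blast
  then have "finite V'" "no_indep k V' E"
    by (rule finite_subset[OF _ Suc.prems(1)], rule no_indep_subset[OF Suc.prems(2)])
  from Suc.IH[OF this] v(2) obtain zs D where zs: "length zs = p" "distinct zs" "set zs \<subseteq> V'"
    "successively E zs" "D \<subseteq> V' - set zs" "card D \<ge> k" "\<forall>z\<in>set zs. \<forall>d\<in>D. E z d"
    unfolding V'_def by blast
  have "v \<notin> V'" using irreflpD[OF assms(2)] unfolding V'_def by blast
  have "successively E (v # zs)"
    using zs(3,4) unfolding V'_def by (cases zs) auto
  then show ?case
    using zs v(1) \<open>v \<notin> V'\<close> unfolding V'_def
    by (intro exI[of _ "v # zs"] exI[of _ D]) auto
qed

text \<open>Any two common neighbours of a clique can be attached to the two ends of a path through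
  it. With \<open>k\<close> of them available, the pair can be chosen adjacent in the second graph
  \<open>E'\<close>.\<close>

lemma path_with_adjacent_ends:
  assumes "symp E" "irreflp E" "k > 0" "finite V" "no_indep k V E" "no_indep k V E'"
    and "card V \<ge> k ^ Suc p" "p > 0"
  shows "\<exists>ys. length ys = p + 2 \<and> distinct ys \<and> set ys \<subseteq> V \<and> successively E ys \<and>
           E' (hd ys) (last ys)"
proof -
  obtain zs D where zs: "length zs = p" "distinct zs" "set zs \<subseteq> V" "successively E zs"
    "D \<subseteq> V - set zs" "card D \<ge> k" "\<forall>z\<in>set zs. \<forall>d\<in>D. E z d"
    using clique_with_common_neighbours[OF assms(1-5,7)] by blast
  obtain S where "S \<subseteq> D" "card S = k" using zs(6) by (meson obtain_subset_with_card_n)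
  then obtain a b where ab: "a \<in> D" "b \<in> D" "a \<noteq> b" "E' a b"
    using \<open>no_indep k V E'\<close> zs(5) unfolding no_indep_def by (metis Diff_subset subset_iff)
  \<comment> \<open>An inner vertex is what links \<open>a\<close> and \<open>b\<close>; this is
    where \<open>p > 0\<close> enters.\<close>
  have "zs \<noteq> []" using zs(1) \<open>p > 0\<close> by auto
  then have "E a (hd zs)" "E (last zs) b"
    using zs(7) ab sympD[OF assms(1)] by auto
  then have "successively E (a # zs @ [b])"
    using zs(4) \<open>zs \<noteq> []\<close> by (auto simp: successively_append_iff successively_Cons)
  then show ?thesis
    using zs ab by (intro exI[of _ "a # zs @ [b]"]) auto
qed

text \<open>The nested neighbourhoods work again, now with a new graph \<open>R c\<close> in each
  round: the rest of the path is built inside the \<open>R c\<close>-neighbourhood of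
  \<open>v\<close>, so its first vertex is joined to \<open>v\<close> in the right graph.\<close>

lemma rainbow_path:
  assumes "\<And>c. symp (R c)" "\<And>c. irreflp (R c)" "k > 0"
    and "finite V" "\<And>c. c \<in> set cs \<Longrightarrow> no_indep k V (R c)" "card V \<ge> k ^ length cs"
  shows "\<exists>xs. length xs = Suc (length cs) \<and> distinct xs \<and> set xs \<subseteq> V \<and>
           (\<forall>i<length cs. R (cs ! i) (xs ! i) (xs ! Suc i))"
  using assms(4-6)
proof (induction cs arbitrary: V)
  case Nil
  then obtain v where "v \<in> V" by fastforce
  then show ?case by (intro exI[of _ "[v]"]) simp
next
  case (Cons c cs)
  obtain v where v: "v \<in> V" "card {u \<in> V. R c v u} \<ge> k ^ length cs"
    by (rule obtain_high_degree[of "R c" V k "k ^ length cs"])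
      (use assms(1) \<open>k > 0\<close> Cons.prems in auto)
  define V' where "V' = {u \<in> V. R c v u}"
  have "V' \<subseteq> V" unfolding V'_def by blast
  then have "finite V'" "\<And>c. c \<in> set cs \<Longrightarrow> no_indep k V' (R c)"
    using finite_subset[OF _ Cons.prems(1)] no_indep_subset[OF Cons.prems(2)] by auto
  from Cons.IH[OF this] v(2) obtain xs where xs: "length xs = Suc (length cs)" "distinct xs"
    "set xs \<subseteq> V'" "\<forall>i<length cs. R (cs ! i) (xs ! i) (xs ! Suc i)"
    unfolding V'_def by blast
  have "v \<notin> V'" using irreflpD[OF assms(2)] unfolding V'_def by blast
  have "xs ! 0 \<in> V'" using xs(1,3) by (metis nth_mem subsetD zero_less_Suc)
  then have "R ((c # cs) ! i) ((v # xs) ! i) ((v # xs) ! Suc i)" if "i < length (c # cs)" for i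
    using that xs(4) unfolding V'_def by (cases i) auto
  then show ?case
    using xs v(1) \<open>v \<notin> V'\<close> \<open>V' \<subseteq> V\<close> by (intro exI[of _ "v # xs"]) auto
qed

section \<open>Double counting and pigeonhole\<close>

text \<open>Triples \<open>(w, x, y)\<close> with \<open>R y w x\<close> are counted twice. Each
  \<open>y\<close> gives at least \<open>k * M * M\<close> of them. If every \<open>w\<close> had
  fewer than \<open>e\<close> rich partners \<open>x\<close>, each \<open>w\<close> would lie in at
  most \<open>e * card Y + card X * L\<close>. The constants 2, 8 and 4 make these bounds
  collide.\<close>

lemma column_with_many_rich_partners:
  fixes R :: "'b \<Rightarrow> 'a \<Rightarrow> 'a \<Rightarrow> bool"
  assumes "finite X" "finite Y" "\<And>y. symp (R y)" "\<And>y. y \<in> Y \<Longrightarrow> no_indep k X (R y)"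
    and "card X = 2 * k * M" "card Y = 8 * k * L" "M > 4 * e" "k > 0" "L > 0"
  shows "\<exists>w\<in>X. card {x \<in> X. card {y \<in> Y. R y w x} \<ge> L} \<ge> e"
proof (rule ccontr)
  assume neg: "\<not> ?thesis"
  have double_count: "(\<Sum>w\<in>X. \<Sum>x\<in>X. card {y \<in> Y. R y w x}) = (\<Sum>y\<in>Y. \<Sum>w\<in>X. card {x \<in> X. R y w x})"
  proof -
    have "(\<Sum>x\<in>X. card {y \<in> Y. R y w x}) = (\<Sum>y\<in>Y. card {x \<in> X. R y w x})" for w
      by (rule sum_multicount_gen) (use assms(1,2) in auto)
    then show ?thesis by (simp add: sum.swap[of _ X Y])
  qed
  have upper: "(\<Sum>x\<in>X. card {y \<in> Y. R y w x}) \<le> e * card Y + card X * L" if "w \<in> X" for w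
  proof -
    let ?G = "{x \<in> X. card {y \<in> Y. R y w x} \<ge> L}"
    \<comment> \<open>A rich partner contributes at most \<open>card Y\<close>, any other one less
      than \<open>L\<close>.\<close>
    have "card {y \<in> Y. R y w x} \<le> (if x \<in> ?G then card Y else 0) + L" if "x \<in> X" for x
      using that card_mono[of Y "{y \<in> Y. R y w x}"] assms(2) by auto
    then have "(\<Sum>x\<in>X. card {y \<in> Y. R y w x}) \<le> (\<Sum>x\<in>X. (if x \<in> ?G then card Y else 0) + L)"
      by (rule sum_mono)
    also have "\<dots> = card ?G * card Y + card X * L"
      using assms(1) by (simp add: sum.distrib sum.If_cases Int_def)
    also have "\<dots> \<le> e * card Y + card X * L"
      using neg that by (simp add: not_le less_imp_le)
    finally show ?thesis .
  qed
  have lower: "k * M * M \<le> (\<Sum>w\<in>X. card {x \<in> X. R y w x})" if "y \<in> Y" for y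
  proof -
    let ?B = "{w \<in> X. card {x \<in> X. R y w x} < M}"
    have "card ?B < k * M"
      using card_low_degree_less[of "R y" X k M] assms that by auto
    \<comment> \<open>Since \<open>card X = 2 * k * M\<close>, at least half of the columns have
      degree at least \<open>M\<close>.\<close>
    then have "k * M \<le> card (X - ?B)"
      using assms(1,5) by (subst card_Diff_subset) auto
    then have "k * M * M \<le> card (X - ?B) * M" by (rule mult_le_mono1)
    also have "\<dots> \<le> (\<Sum>w\<in>X - ?B. card {x \<in> X. R y w x})"
    proof -
      have "M \<le> card {x \<in> X. R y w x}" if "w \<in> X - ?B" for w using that by auto
      from sum_bounded_below[of "X - ?B" M, OF this] show ?thesis by simp
    qed
    also have "\<dots> \<le> (\<Sum>w\<in>X. card {x \<in> X. R y w x})"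
      using assms(1) by (intro sum_mono2) auto
    finally show ?thesis .
  qed
  have "card Y * (k * M * M) \<le> (\<Sum>y\<in>Y. \<Sum>w\<in>X. card {x \<in> X. R y w x})"
    using sum_bounded_below[of Y "k * M * M"] lower by auto
  also have "\<dots> \<le> card X * (e * card Y + card X * L)"
    unfolding double_count[symmetric] using sum_bounded_above[of X _ "e * card Y + card X * L"] upper
    by auto
  finally have "k * k * L * M * (8 * M) \<le> k * k * L * M * (16 * e + 4 * M)"
    unfolding assms(5,6) by (simp add: algebra_simps)
  \<comment> \<open>The common factor is positive because \<open>M > 4 * e\<close> forces
    \<open>M > 0\<close>.\<close>
  then have "8 * M \<le> 16 * e + 4 * M"
    using assms(7-9) by (subst (asm) mult_le_cancel1) simp
  then show False using assms(7) by simp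
qed

lemma pigeonhole_large_fibre:
  assumes "finite A" "finite B" "f ` A \<subseteq> B" "card A \<ge> card B * q" "B \<noteq> {}"
  shows "\<exists>b\<in>B. card {a \<in> A. f a = b} \<ge> q"
proof (rule ccontr)
  assume neg: "\<not> ?thesis"
  have "A = (\<Union>b\<in>B. {a \<in> A. f a = b})" using assms(3) by blast
  then have "card A \<le> (\<Sum>b\<in>B. card {a \<in> A. f a = b})"
    using card_UN_le[OF assms(2), of "\<lambda>b. {a \<in> A. f a = b}"] by simp
  also have "\<dots> < (\<Sum>b\<in>B. q)"
    using neg assms(2,5) by (intro sum_strict_mono) (auto simp: not_le)
  finally show False using assms(4) by simp
qed

section \<open>Edges of the alternating cycle\<close>

text \<open>A closed form by position: \<open>j div 2\<close> counts the completed pairs and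
  \<open>j mod 2\<close> selects the vertex within a pair.\<close>

lemma alt_cycle_list_eq:
  "alt_cycle_list (Suc n) =
     map (\<lambda>j. (j div 2 + 1 + j mod 2, j div 2 + 1)) [0..<2 * n] @ [(Suc n, Suc n), (1, Suc n)]"
proof -
  have "concat (map (\<lambda>i. [(i, i), (i + 1, i)]) [1..<Suc n]) =
          map (\<lambda>j. (j div 2 + 1 + j mod 2, j div 2 + 1)) [0..<2 * n]"
    by (induction n) auto
  then show ?thesis unfolding alt_cycle_list_def by simp
qed

text \<open>Even positions start row edges and odd positions start column edges; the last edge of
  each kind closes the cycle and gets its own case.\<close>

lemma cycle_edges_alt_cycle_list:
  assumes "e \<in> cycle_edges (alt_cycle_list m)" "m > 0"
  obtains i where "1 \<le> i" "i < m" "e = {(i, i), (i + 1, i)}"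
  | i where "1 \<le> i" "i < m" "e = {(i + 1, i), (i + 1, i + 1)}"
  | "e = {(m, m), (1, m)}"
  | "e = {(1, m), (1, 1)}"
proof -
  obtain n where m: "m = Suc n" using \<open>m > 0\<close> by (cases m) auto
  let ?vs = "alt_cycle_list m"
  have len: "length ?vs = 2 * n + 2" unfolding m alt_cycle_list_eq by simp
  \<comment> \<open>The vertex \<open>(m, m)\<close> at position \<open>2 * n\<close> still fits the
    closed form; only the final \<open>(1, m)\<close> is exceptional.\<close>
  have nth: "?vs ! j = (if j = 2 * n + 1 then (1, m) else (j div 2 + 1 + j mod 2, j div 2 + 1))"
    if j: "j < 2 * n + 2" for j
  proof -
    consider "j < 2 * n" | "j = 2 * n" | "j = 2 * n + 1" using j by linarith
    then show ?thesis by cases (auto simp: m alt_cycle_list_eq nth_append)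
  qed
  obtain j where j: "j < 2 * n + 2" "e = {?vs ! j, ?vs ! (Suc j mod (2 * n + 2))}"
    using assms(1) len unfolding cycle_edges_def by auto
  consider "j = 2 * n + 1" | "j = 2 * n" | i where "j = 2 * i" "i < n" | i where "j = 2 * i + 1" "i < n"
  proof (cases "even j")
    case True
    then obtain i where "j = 2 * i" by (auto elim: evenE)
    then show ?thesis using that j(1) by (cases "i = n") auto
  next
    case False
    then obtain i where "j = 2 * i + 1" by (auto elim: oddE)
    then show ?thesis using that j(1) by (cases "i = n") auto
  qed
  then show ?thesis
  proof cases
    case 1
    then show ?thesis using that(4) j(2) nth[of j] nth[of 0] by simp
  next
    case 2
    then show ?thesis using that(3) j(2) nth[of j] nth[of "Suc j"] m by simp
  next
    case 3
    then show ?thesis using that(1)[of "Suc i"] j(2) nth[of j] nth[of "Suc j"] m by simp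
  next
    case 4
    then show ?thesis using that(2)[of "Suc i"] j(2) nth[of j] nth[of "Suc j"] m by simp
  qed
qed

text \<open>Index 0 of \<open>xs\<close> and \<open>ys\<close> is column 1 and row 1 of the cycle.\<close>

lemma grid_contains_AC:
  assumes "m > 0" "length xs = m" "length ys = m" "distinct xs" "distinct ys"
    and "set xs \<subseteq> {1..gcols G}" "set ys \<subseteq> {1..grows G}"
    and row: "\<And>i. Suc i < m \<Longrightarrow> {(xs ! i, ys ! i), (xs ! Suc i, ys ! i)} \<in> gedges G"
    and col: "\<And>i. Suc i < m \<Longrightarrow> {(xs ! Suc i, ys ! i), (xs ! Suc i, ys ! Suc i)} \<in> gedges G"
    and last_row: "{(xs ! (m - 1), ys ! (m - 1)), (xs ! 0, ys ! (m - 1))} \<in> gedges G"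
    and last_col: "{(xs ! 0, ys ! (m - 1)), (xs ! 0, ys ! 0)} \<in> gedges G"
  shows "grid_contains G (AC (2 * m))"
proof -
  let ?c = "\<lambda>i. xs ! (i - 1)" and ?r = "\<lambda>i. ys ! (i - 1)"
  have "inj_on ?c {1..m}" "inj_on ?r {1..m}"
    using assms(2-5) by (auto simp: inj_on_def nth_eq_iff_index_eq)
  moreover have "?c ` {1..m} \<subseteq> set xs" "?r ` {1..m} \<subseteq> set ys"
    using assms(2,3) by auto
  moreover have "map_prod ?c ?r ` e \<in> gedges G" if "e \<in> cycle_edges (alt_cycle_list m)" for e
    using that \<open>m > 0\<close>
  proof (cases rule: cycle_edges_alt_cycle_list)
    case (1 i)
    then show ?thesis using row[of "i - 1"] by simp
  next
    case (2 i)
    then show ?thesis using col[of "i - 1"] by simp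
  next
    case 3
    then show ?thesis using last_row by simp
  next
    case 4
    then show ?thesis using last_col by simp
  qed
  ultimately have "grid_embedding (AC (2 * m)) G ?c ?r"
    using assms(6,7) unfolding grid_embedding_def AC_def by (simp add: subset_trans[of _ "set _"])
  then show ?thesis unfolding grid_contains_def by blast
qed

section \<open>Construction of the cycle\<close>

text \<open>The sizes are read backwards: \<open>k ^ p\<close> columns carry a rainbow path with
  \<open>p\<close> edges, \<open>K ^ m\<close> bounds the number of row lists, and
  \<open>k ^ Suc p\<close> rows suffice for such a list. Double counting with these values gives
  \<open>K\<close> and \<open>N\<close>, the factor 5 serving \<open>M > 4 * e\<close>.\<close>

lemma AC_or_coclique:
  fixes k p :: nat
  defines "m \<equiv> p + 2"
  defines "K \<equiv> 8 * k * k ^ Suc p"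
  defines "N \<equiv> 2 * k * (5 * (K ^ m * k ^ p))"
  assumes G: "spanning_grid_subgraph N G" and "k > 0" "p > 0"
  shows "grid_contains G (AC (2 * m)) \<or> (\<exists>S. coclique G k S)"
proof (rule ccontr)
  assume neg: "\<not> ?thesis"
  define R where "R y u v \<longleftrightarrow> {(u, y), (v, y)} \<in> gedges G" for y u v
  define C where "C x a b \<longleftrightarrow> {(x, a), (x, b)} \<in> gedges G" for x a b
  have verts: "gverts G = {1..N} \<times> {1..N}" and size: "gcols G = N" "grows G = N"
    and edges: "gedges G \<subseteq> {{u, v} | u v. u \<in> gverts G \<and> v \<in> gverts G \<and> u \<noteq> v \<and> same_line u v}"
    using G unfolding spanning_grid_subgraph_def grid_subgraph_def full_grid_def by auto
  have no_loop: "{u, u} \<notin> gedges G" for u using edges by fastforce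
  have sym: "symp (R y)" "symp (C x)" for x y
    unfolding R_def C_def by (auto intro!: sympI simp: insert_commute)
  have irrefl: "irreflp (R y)" "irreflp (C x)" for x y
    unfolding R_def C_def using no_loop by (auto intro!: irreflpI)
  have R_indep: "no_indep k {1..N} (R y)" if "y \<in> {1..N}" for y
    unfolding no_indep_def
  proof (intro allI impI, rule ccontr)
    fix S assume S: "S \<subseteq> {1..N}" "card S = k" "\<not> (\<exists>u\<in>S. \<exists>v\<in>S. u \<noteq> v \<and> R y u v)"
    have "finite S" using S(1) finite_subset by blast
    then have "coclique G k ((\<lambda>u. (u, y)) ` S)"
      using S that unfolding coclique_def indep_def verts R_def
      by (auto simp: card_image inj_on_def)
    then show False using neg by blast
  qed
  have C_indep: "no_indep k {1..N} (C x)" if "x \<in> {1..N}" for x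
    unfolding no_indep_def
  proof (intro allI impI, rule ccontr)
    fix S assume S: "S \<subseteq> {1..N}" "card S = k" "\<not> (\<exists>u\<in>S. \<exists>v\<in>S. u \<noteq> v \<and> C x u v)"
    have "finite S" using S(1) finite_subset by blast
    then have "coclique G k ((\<lambda>u. (x, u)) ` S)"
      using S that unfolding coclique_def indep_def verts C_def
      by (auto simp: card_image inj_on_def)
    then show False using neg by blast
  qed
  have "K > 0" unfolding K_def using \<open>k > 0\<close> by simp
  have "K \<le> K ^ m" unfolding m_def by (simp add: self_le_power \<open>K > 0\<close> Suc_leI)
  also have "\<dots> \<le> K ^ m * (10 * k * k ^ p)" using \<open>k > 0\<close> by simp
  also have "\<dots> = N" unfolding N_def by simp
  finally have "{1..K} \<subseteq> {1..N}" by simp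
  \<comment> \<open>Only the first \<open>K\<close> rows are used, which keeps the number of row
    lists small compared with the number of columns.\<close>
  have "\<exists>w\<in>{1..N}. K ^ m * k ^ p \<le> card {x \<in> {1..N}. k ^ Suc p \<le> card {y \<in> {1..K}. R y w x}}"
  proof (rule column_with_many_rich_partners[of _ _ R k "5 * (K ^ m * k ^ p)"])
    show "no_indep k {1..N} (R y)" if "y \<in> {1..K}" for y
      using that R_indep \<open>{1..K} \<subseteq> {1..N}\<close> by blast
    show "card {1..N} = 2 * k * (5 * (K ^ m * k ^ p))" by (simp add: N_def)
    show "card {1..K} = 8 * k * k ^ Suc p" by (simp add: K_def)
  qed (use sym \<open>k > 0\<close> \<open>K > 0\<close> in auto)
  then obtain w where w: "w \<in> {1..N}"
    "K ^ m * k ^ p \<le> card {x \<in> {1..N}. k ^ Suc p \<le> card {y \<in> {1..K}. R y w x}}" by blast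
  define X where "X = {x \<in> {1..N}. k ^ Suc p \<le> card {y \<in> {1..K}. R y w x}}"
  have "\<exists>ys. length ys = m \<and> distinct ys \<and> set ys \<subseteq> {y \<in> {1..K}. R y w x} \<and>
          successively (C x) ys \<and> C w (hd ys) (last ys)" (is "\<exists>ys. ?P x ys") if "x \<in> X" for x
  proof -
    have "{y \<in> {1..K}. R y w x} \<subseteq> {1..N}" using \<open>{1..K} \<subseteq> {1..N}\<close> by blast
    then have "no_indep k {y \<in> {1..K}. R y w x} (C x)" "no_indep k {y \<in> {1..K}. R y w x} (C w)"
      using that w(1) C_indep no_indep_subset unfolding X_def by blast+
    then show ?thesis
      unfolding m_def using that sym irrefl \<open>k > 0\<close> \<open>p > 0\<close>
      by (intro path_with_adjacent_ends) (auto simp: X_def)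
  qed
  then obtain f where f: "\<And>x. x \<in> X \<Longrightarrow> ?P x (f x)"
    using bchoice[of X ?P] by blast
  define B where "B = {ys. set ys \<subseteq> {1..K} \<and> length ys = m}"
  have "finite B" "card B = K ^ m"
    unfolding B_def using card_lists_length_eq[of "{1..K}" m] finite_lists_length_eq[of "{1..K}" m]
    by simp_all
  moreover have "f ` X \<subseteq> B" using f unfolding B_def by fastforce
  moreover have "finite X" unfolding X_def by simp
  moreover have "card X \<ge> K ^ m * k ^ p" using w(2) unfolding X_def .
  moreover have "B \<noteq> {}" using \<open>card B = K ^ m\<close> \<open>K > 0\<close> by auto
  ultimately obtain ys where ys: "k ^ p \<le> card {x \<in> X. f x = ys}"
    using pigeonhole_large_fibre[of X B f "k ^ p"] by auto
  \<comment> \<open>In every column of \<open>E\<close> the same list \<open>ys\<close> is a path,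
    and each of its rows joins that column to \<open>w\<close>.\<close>
  define E where "E = {x \<in> X. f x = ys}"
  have "E \<subseteq> {1..N}" unfolding E_def X_def by blast
  then have "finite E" using finite_subset by blast
  have "card E > 0" using ys \<open>k > 0\<close> unfolding E_def by (metis less_le_trans zero_less_power)
  then have "E \<noteq> {}" by auto
  then obtain x0 where "x0 \<in> E" by blast
  have E_props: "length ys = m \<and> distinct ys \<and> set ys \<subseteq> {y \<in> {1..K}. R y w x} \<and>
      successively (C x) ys \<and> C w (hd ys) (last ys)" if "x \<in> E" for x
  proof -
    have x: "x \<in> X" "f x = ys" using that unfolding E_def by simp_all
    from f[OF x(1)] show ?thesis unfolding x(2) .
  qed
  then have path: "successively (C x) ys" "\<And>y. y \<in> set ys \<Longrightarrow> R y w x" if "x \<in> E" for x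
    using that by blast+
  have ys_props: "length ys = m" "distinct ys" "set ys \<subseteq> {1..N}" "C w (hd ys) (last ys)"
    using E_props[OF \<open>x0 \<in> E\<close>] \<open>{1..K} \<subseteq> {1..N}\<close> by blast+
  \<comment> \<open>These are the inner rows of \<open>ys\<close>. The first and the last row are
    reserved for the two edges at \<open>w\<close>.\<close>
  define cs where "cs = take p (tl ys)"
  have cs: "length cs = p" "\<And>i. i < p \<Longrightarrow> cs ! i = ys ! Suc i"
    unfolding cs_def using ys_props(1) by (auto simp: m_def nth_tl)
  have "set cs \<subseteq> {1..N}"
    using ys_props(3) unfolding cs_def by (cases ys) (auto dest: in_set_takeD)
  then have "no_indep k E (R c)" if "c \<in> set cs" for c
    using that R_indep no_indep_subset[OF _ \<open>E \<subseteq> {1..N}\<close>] by blast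
  then obtain xs where xs: "length xs = Suc p" "distinct xs" "set xs \<subseteq> E"
    "\<And>i. i < p \<Longrightarrow> R (ys ! Suc i) (xs ! i) (xs ! Suc i)"
    using rainbow_path[of R k E cs, OF sym(1) irrefl(1) \<open>k > 0\<close> \<open>finite E\<close>] ys cs
    unfolding E_def[symmetric] by auto
  have xs_in: "xs ! i \<in> E" if "i < Suc p" for i
    using that xs(1,3) nth_mem[of i xs] by auto
  \<comment> \<open>Otherwise \<open>w\<close> would be adjacent to itself in a row of
    \<open>ys\<close>.\<close>
  have "w \<notin> E"
  proof
    assume "w \<in> E"
    then have "R (hd ys) w w" using path(2) ys_props(1) unfolding m_def by (cases ys) auto
    then show False using irreflpD[OF irrefl(1)] by blast
  qed
  have "grid_contains G (AC (2 * m))"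
  proof (rule grid_contains_AC[of m "w # xs" ys])
    show "m > 0" "length (w # xs) = m" "length ys = m" "distinct ys" "set ys \<subseteq> {1..grows G}"
      using xs(1) ys_props size by (auto simp: m_def)
    show "distinct (w # xs)" "set (w # xs) \<subseteq> {1..gcols G}"
      using xs \<open>w \<notin> E\<close> w(1) \<open>E \<subseteq> {1..N}\<close> size by auto
  next
    fix i assume i: "Suc i < m"
    \<comment> \<open>The first row edge starts at \<open>w\<close>; the later ones come from the
      rainbow path, with the index shifted by one.\<close>
    have "R (ys ! i) ((w # xs) ! i) ((w # xs) ! Suc i)"
    proof (cases i)
      case 0
      then show ?thesis using path(2)[OF xs_in[of 0]] i ys_props(1) by simp
    next
      case (Suc j)
      then show ?thesis using xs(4)[of j] i by (simp add: m_def)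
    qed
    then show "{((w # xs) ! i, ys ! i), ((w # xs) ! Suc i, ys ! i)} \<in> gedges G"
      unfolding R_def .
    have "C (xs ! i) (ys ! i) (ys ! Suc i)"
      using path(1)[OF xs_in[of i]] i ys_props(1)
      by (simp add: successively_conv_nth m_def)
    then show "{((w # xs) ! Suc i, ys ! i), ((w # xs) ! Suc i, ys ! Suc i)} \<in> gedges G"
      unfolding C_def by simp
  next
    have "R (ys ! (m - 1)) w (xs ! p)"
      using path(2)[OF xs_in[of p]] ys_props(1) by (simp add: m_def)
    then show "{((w # xs) ! (m - 1), ys ! (m - 1)), ((w # xs) ! 0, ys ! (m - 1))} \<in> gedges G"
      unfolding R_def by (simp add: m_def insert_commute)
    have "ys \<noteq> []" using ys_props(1) by (auto simp: m_def)
    then have "C w (ys ! 0) (ys ! (m - 1))"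
      using ys_props(1,4) by (simp add: hd_conv_nth last_conv_nth)
    then show "{((w # xs) ! 0, ys ! (m - 1)), ((w # xs) ! 0, ys ! 0)} \<in> gedges G"
      unfolding C_def by (simp add: insert_commute)
  qed
  then show False using neg by blast
qed

section \<open>The polynomial bound\<close>

lemma gr_le:
  assumes "\<And>G. spanning_grid_subgraph N G \<Longrightarrow> grid_contains G H \<or> (\<exists>S. coclique G k S)"
  shows "gr H k \<le> enat N"
  unfolding gr_def using assms by (intro Inf_lower) auto

theorem theorem3p6:
  fixes t :: nat
  assumes "even t" and "t \<ge> 6"
  shows "\<exists>C::real. \<forall>k::nat. k \<ge> 2 \<longrightarrow> ereal_of_enat (gr (AC t) k) \<le> ereal (real k powr C)"
proof -
  obtain m where m: "t = 2 * m" using \<open>even t\<close> by (auto elim: evenE)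
  define p where "p = m - 2"
  have p: "m = p + 2" "p > 0" using \<open>t \<ge> 6\<close> m unfolding p_def by auto
  \<comment> \<open>Here 5 comes from \<open>10 * k \<le> k ^ 5\<close>, \<open>(p + 5) * m\<close>
    from \<open>?K \<le> k ^ (p + 5)\<close>, and the last \<open>p\<close> from the factor
    \<open>k ^ p\<close>.\<close>
  define c where "c = 5 + (p + 5) * m + p"
  have "ereal_of_enat (gr (AC t) k) \<le> ereal (real k powr real c)" if "k \<ge> 2" for k
  proof -
    let ?K = "8 * k * k ^ Suc p"
    let ?N = "2 * k * (5 * (?K ^ m * k ^ p))"
    have "gr (AC t) k \<le> enat ?N"
      unfolding m p(1) using p(2) that by (intro gr_le AC_or_coclique) auto
    then have "ereal_of_enat (gr (AC t) k) \<le> ereal_of_enat (enat ?N)"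
      by (simp only: ereal_of_enat_le_iff)
    also have "\<dots> = ereal (real ?N)" by (simp only: ereal_of_enat_simps)
    also have "\<dots> \<le> ereal (real (k ^ c))"
    proof -
      \<comment> \<open>As \<open>k \<ge> 2\<close>, constant factors are absorbed into powers of
        \<open>k\<close>.\<close>
      have "(2::nat) ^ 3 \<le> k ^ 3" "(2::nat) ^ 4 \<le> k ^ 4" using that by (intro power_mono; simp)+
      then have k: "8 \<le> k ^ 3" "10 \<le> k ^ 4" by auto
      have "?K \<le> k ^ 3 * k * k ^ Suc p" using k by (intro mult_le_mono) auto
      also have "\<dots> = k ^ (p + 5)" by (simp add: power_add power_numeral_reduce)
      finally have "?K ^ m \<le> (k ^ (p + 5)) ^ m" by (rule power_mono) simp
      then have "10 * k * (?K ^ m * k ^ p) \<le> k ^ 4 * k * ((k ^ (p + 5)) ^ m * k ^ p)"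
        using k by (intro mult_le_mono) auto
      also have "\<dots> = k ^ c" unfolding c_def by (simp add: power_add power_mult power_numeral_reduce)
      finally have "?N \<le> k ^ c" by (simp add: ac_simps)
      then show ?thesis by (simp only: ereal_less_eq of_nat_le_iff)
    qed
    also have "real (k ^ c) = real k powr real c" using that by (simp add: powr_realpow)
    finally show ?thesis .
  qed
  then show ?thesis by blast
qed

end
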